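(* Let $p\ge1$ be an integer, let $\mu_0,\ldots,\mu_p$ be Borel probability measures with compact support in $\mathbb{C}$, and for each $0\le k\le p$ let $(a_n^{(k)})_{n\ge1}$ be i.i.d. complex random variables with distribution $\mu_k$, such that the whole collection $\{a_n^{(k)}:n\ge1,0\le k\le p\}$ is jointly independent and surely bounded in modulus by an absolute constant. Let $H_n$ be the random $n\times n$ banded Hessenberg matrix built from these variables, and let $\sigma_n$ be its empirical spectral measure. If the eigenvalues of $H_n$ are all real for every $n$, then the mean measure $\mathbb{E}\sigma_n$ converges weakly, as $n\to\infty$, to a probability distribution on the real line.
   Context: $H_n=(h_{i,j})_{1\le i,j\le n}$ has entries $h_{j-1,j}=1$ for $2\le j\le n$; $h_{j+k,j}=a_j^{(k)}$ for $0\le k\le p$, $1\le j\le n-k$; and $h_{i,j}=0$ otherwise. If $\lambda_{1,n},\ldots,\lambda_{n,n}$ are its eigenvalues counted with multiplicity, $\sigma_n=\frac1n\sum_{i=1}^n\delta_{\lambda_{i,n}}$. The mean $\mathbb{E}\sigma_n$ is the probability measure defined by $\int f\,d\mathbb{E}\sigma_n=\mathbb{E}\int f\,d\sigma_n$ for every continuous function $f$. *)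

theory Defs
  imports "HOL-Probability.Probability" "Jordan_Normal_Form.Char_Poly"
begin

text \<open>
  Matrices of \<^theory>\<open>Jordan_Normal_Form.Matrix\<close> are indexed from 0, so the entry of row \<open>i\<close> and
  column \<open>j\<close> below is $h_{i+1,j+1}$; the sequences \<open>a k\<close> keep their indices \<open>1, 2, \<dots>\<close>.
\<close>

definition banded_hessenberg :: "nat \<Rightarrow> (nat \<Rightarrow> nat \<Rightarrow> complex) \<Rightarrow> nat \<Rightarrow> complex mat" where
  "banded_hessenberg p a n = Matrix.mat n n (\<lambda>(i, j).
     if j = i + 1 then 1
     else if j \<le> i \<and> i \<le> j + p then a (i - j) (j + 1)
     else 0)"

definition eigenvalue_mset :: "complex mat \<Rightarrow> complex multiset" where
  "eigenvalue_mset A = proots (char_poly A)"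

definition empirical_spectral_measure :: "complex mat \<Rightarrow> complex measure" where
  "empirical_spectral_measure A = measure_of UNIV (sets borel)
     (\<lambda>B. (\<Sum>z\<in>#eigenvalue_mset A. emeasure (return borel z) B) / of_nat (dim_row A))"

lemma sets_empirical_spectral_measure [simp]:
  "sets (empirical_spectral_measure A) = sets borel"
  unfolding empirical_spectral_measure_def
  using sets.sigma_sets_eq[of "borel :: complex measure"] sets.space_closed[of "borel :: complex measure"]
  by simp

lemma emeasure_empirical_spectral_measure:
  assumes "B \<in> sets borel"
  shows "emeasure (empirical_spectral_measure A) B =
    (\<Sum>z\<in>#eigenvalue_mset A. indicator B z) / of_nat (dim_row A)"
proof -
  let ?f = "\<lambda>B. (\<Sum>z\<in>#eigenvalue_mset A. emeasure (return borel z) B) / of_nat (dim_row A) :: ennreal"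
  have ca: "(\<Sum>i. \<Sum>z\<in>#N. emeasure (return borel z) (F i)) =
      (\<Sum>z\<in>#N. emeasure (return borel z) (\<Union>i. F i))"
    if "range F \<subseteq> sets borel" "disjoint_family F" for F :: "nat \<Rightarrow> complex set" and N
  proof (induction N)
    case (add z N)
    have "(\<Sum>i. emeasure (return borel z) (F i)) = emeasure (return borel z) (\<Union>i. F i)"
      using that by (intro suminf_emeasure) auto
    then show ?case
      using add.IH by (simp add: suminf_add[symmetric])
  qed simp
  have "countably_additive (sets borel) ?f"
    unfolding countably_additive_def by (simp add: ennreal_suminf_divide ca del: emeasure_return)
  moreover have "positive (sets borel) ?f"
    by (simp add: positive_def)
  moreover have "sigma_algebra UNIV (sets (borel :: complex measure))"
    using sets.sigma_algebra_axioms[of "borel :: complex measure"] by simp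
  ultimately have "emeasure (empirical_spectral_measure A) B = ?f B"
    unfolding empirical_spectral_measure_def
    using assms by (intro emeasure_measure_of_sigma) auto
  then show ?thesis
    using assms by simp
qed

text \<open>The random measure is a family \<open>\<sigma>\<close> of measures indexed by the sample space of \<open>M\<close>.\<close>

definition is_mean_measure :: "'w measure \<Rightarrow> ('w \<Rightarrow> complex measure) \<Rightarrow> complex measure \<Rightarrow> bool" where
  "is_mean_measure M \<sigma> \<nu> \<longleftrightarrow>
     prob_space \<nu> \<and> sets \<nu> = sets borel \<and>
     (\<forall>f :: complex \<Rightarrow> real. continuous_on UNIV f \<longrightarrow>
        integral\<^sup>L \<nu> f = integral\<^sup>L M (\<lambda>\<omega>. integral\<^sup>L (\<sigma> \<omega>) f))"

definition mean_measure :: "'w measure \<Rightarrow> ('w \<Rightarrow> complex measure) \<Rightarrow> complex measure" where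
  "mean_measure M \<sigma> = (THE \<nu>. is_mean_measure M \<sigma> \<nu>)"

definition measure_support :: "'a::topological_space measure \<Rightarrow> 'a set" where
  "measure_support \<mu> = {x. \<forall>U. open U \<longrightarrow> x \<in> U \<longrightarrow> 0 < emeasure \<mu> U}"

text \<open>The library's \<open>weak_conv_m\<close>, based on distribution functions, only covers measures on the reals.\<close>

definition weakly_converges ::
    "(nat \<Rightarrow> 'a::topological_space measure) \<Rightarrow> 'a measure \<Rightarrow> bool" where
  "weakly_converges \<nu> \<nu>' \<longleftrightarrow>
     (\<forall>f :: 'a \<Rightarrow> real. continuous_on UNIV f \<longrightarrow> bounded (range f) \<longrightarrow>
        (\<lambda>n. integral\<^sup>L (\<nu> n) f) \<longlonglongrightarrow> integral\<^sup>L \<nu>' f)"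

end

theory Submission
  imports Defs "Jordan_Normal_Form.Schur_Decomposition"
begin

text \<open>
  The proof is the method of moments. Since \<open>\<Sum>\<lambda>\<^sup>k = tr H\<^sup>k\<close>, the \<open>k\<close>-th moment of the mean measure
  is the expectation of the normalised trace of \<open>H\<^sup>k\<close>. A diagonal entry of \<open>H\<^sup>k\<close> sums the weights of
  the closed walks of length \<open>k\<close> through its index. The band structure confines such a walk to a window
  of fixed width: a step lowers the index by at most \<open>p\<close> and raises it by at most one. Away from
  the two ends of the diagonal the entry is therefore a fixed function of finitely many of the
  variables near its index, and since the variables are jointly independent and identically distributed
  along each diagonal, its expectation does not depend on the position (\<open>expectation_walk_sum_shift\<close>). Only boundedly many entries are
  affected by the ends, and they are uniformly bounded, so the normalised traces converge in mean
  (\<open>expectation_trace_tendsto\<close>).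

  The eigenvalues lie in a disc whose radius does not depend on \<open>n\<close>, because the row sums of
  the matrices are bounded. Being real as well, they make the mean measures live on one compact
  interval, where polynomials are dense in the continuous functions. So the convergence of moments
  gives convergence of all integrals of continuous functions, and Helly's theorem supplies a measure
  that represents the limit functional (\<open>weak_limit_of_convergent_moments\<close>).

  It remains to see that the mean measure exists, which is a question of measurability: the matrix
  entries are random variables, but the eigenvalues are not given by a formula. The number of
  eigenvalues in a closed set is nevertheless measurable (\<open>sets_eigenvalue_count_ge\<close>), because
  the tuples of bounded roots with enough members in the set form a compact set, whose image under
  the passage from roots to polynomials is closed. The random spectral measure is then a Markov
  kernel, and its composition with the law of the sample point is the mean measure
  (\<open>bind_empirical\<close>).
\<close>

section \<open>Eigenvalues, traces of powers and row sums\<close>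

text \<open>The dollar sign is reserved for the components of vectors whose dimension is not part of the type.\<close>

unbundle no vec_syntax

lemma char_poly_eigenvalue_mset:
  assumes "A \<in> carrier_mat n n"
  shows "char_poly A = (\<Prod>z\<in>#eigenvalue_mset A. [:-z, 1:])"
  using complex_poly_decompose_multiset[of "char_poly A"] degree_monic_char_poly[OF assms]
  by (simp add: eigenvalue_mset_def)

lemma size_eigenvalue_mset:
  assumes "A \<in> carrier_mat n n"
  shows "size (eigenvalue_mset A) = n"
  using degree_monic_char_poly[OF assms] by (simp add: eigenvalue_mset_def size_proots_complex)

lemma set_eigenvalue_mset:
  assumes "A \<in> carrier_mat n n"
  shows "z \<in># eigenvalue_mset A \<longleftrightarrow> eigenvalue A z"
proof -
  have "char_poly A \<noteq> 0"
    using degree_monic_char_poly[OF assms] by (metis coeff_0 zero_neq_one)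
  then show ?thesis
    by (simp add: eigenvalue_mset_def eigenvalue_root_char_poly[OF assms])
qed

lemma proots_prod_mset_linear:
  fixes X :: "'a::idom multiset"
  shows "proots (\<Prod>z\<in>#X. [:-z, 1:]) = X"
proof (induction X)
  case (add z X)
  have "(\<Prod>z\<in>#X. [:-z, 1:]) \<noteq> 0"
    by (auto simp: prod_mset_zero_iff)
  then have "proots ([:-z, 1:] * (\<Prod>z\<in>#X. [:-z, 1:])) = add_mset z (proots (\<Prod>z\<in>#X. [:-z, 1:]))"
    by (subst proots_mult) auto
  then show ?case
    using add by (simp del: mult_pCons_left)
qed simp

lemma trace_mult_commute:
  fixes A B :: "'a::comm_semiring_0 mat"
  assumes "A \<in> carrier_mat n n" "B \<in> carrier_mat n n"
  shows "(\<Sum>i<n. (A * B) $$ (i, i)) = (\<Sum>i<n. (B * A) $$ (i, i))"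
proof -
  have "(\<Sum>i<n. (A * B) $$ (i, i)) = (\<Sum>i<n. \<Sum>j<n. A $$ (i, j) * B $$ (j, i))"
    using assms by (simp add: scalar_prod_def atLeast0LessThan)
  also have "\<dots> = (\<Sum>j<n. \<Sum>i<n. B $$ (j, i) * A $$ (i, j))"
    by (subst sum.swap) (simp add: mult.commute)
  also have "\<dots> = (\<Sum>i<n. (B * A) $$ (i, i))"
    using assms by (simp add: scalar_prod_def atLeast0LessThan)
  finally show ?thesis .
qed

lemma upper_triangular_pow_mat:
  fixes B :: "'a::comm_ring_1 mat"
  assumes B: "B \<in> carrier_mat n n" and ut: "upper_triangular B"
  shows "(\<forall>i<n. \<forall>j<i. (B ^\<^sub>m k) $$ (i, j) = 0) \<and> (\<forall>i<n. (B ^\<^sub>m k) $$ (i, i) = (B $$ (i, i)) ^ k)"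
proof (induction k)
  case 0
  then show ?case using B by auto
next
  case (Suc k)
  have Bk: "B ^\<^sub>m k \<in> carrier_mat n n"
    using B by (rule pow_carrier_mat)
  have entry: "(B ^\<^sub>m Suc k) $$ (i, j) = (\<Sum>l<n. (B ^\<^sub>m k) $$ (i, l) * B $$ (l, j))"
    if "i < n" "j < n" for i j
    using that B Bk by (simp add: scalar_prod_def atLeast0LessThan)
  have low: "(B ^\<^sub>m k) $$ (i, l) * B $$ (l, j) = 0" if "i < n" "l < n" "j \<le> i" "l \<noteq> i \<or> j < i" for i j l
  proof (cases "l < i")
    case True
    then show ?thesis using Suc that by simp
  next
    case False
    then have "j < l" using that by auto
    then show ?thesis using ut B that by (auto simp: upper_triangular_def)
  qed
  have "(B ^\<^sub>m Suc k) $$ (i, j) = 0" if "i < n" "j < i" for i j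
    unfolding entry[OF that(1) less_trans[OF that(2,1)]]
    using that low by (intro sum.neutral) auto
  moreover have "(B ^\<^sub>m Suc k) $$ (i, i) = (B $$ (i, i)) ^ Suc k" if "i < n" for i
  proof -
    have "(B ^\<^sub>m Suc k) $$ (i, i) = (\<Sum>l\<in>{i}. (B ^\<^sub>m k) $$ (i, l) * B $$ (l, i))"
      unfolding entry[OF that that] using that low by (intro sum.mono_neutral_right) auto
    then show ?thesis using Suc that by (simp add: mult.commute)
  qed
  ultimately show ?case by blast
qed

text \<open>
  By Schur's theorem \<open>A\<close> is similar to an upper triangular matrix with the eigenvalues on the
  diagonal; both the trace and the passage to powers are compatible with similarity.
\<close>

lemma sum_eigenvalues_power:
  assumes A: "A \<in> carrier_mat n n"
  shows "(\<Sum>z\<in>#eigenvalue_mset A. z ^ k) = (\<Sum>i<n. (A ^\<^sub>m k) $$ (i, i))"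
proof -
  obtain es where es: "mset es = eigenvalue_mset A"
    using ex_mset by blast
  have "char_poly A = (\<Prod>e\<leftarrow>es. [:-e, 1:])"
    by (simp add: char_poly_eigenvalue_mset[OF A] flip: es mset_map prod_mset_prod_list)
  moreover obtain B P Q where schur: "schur_decomposition A es = (B, P, Q)"
    by (cases "schur_decomposition A es") auto
  ultimately have wit: "similar_mat_wit A B P Q" and ut: "upper_triangular B" and diag: "diag_mat B = es"
    using schur_decomposition[OF A] by blast+
  have PQ: "P \<in> carrier_mat n n" "Q \<in> carrier_mat n n" "Q * P = 1\<^sub>m n" and B: "B \<in> carrier_mat n n"
    using similar_mat_witD2[OF A wit] by auto
  have Bk: "B ^\<^sub>m k \<in> carrier_mat n n"
    using B by (rule pow_carrier_mat)
  have "(\<Sum>i<n. (A ^\<^sub>m k) $$ (i, i)) = (\<Sum>i<n. (P * B ^\<^sub>m k * Q) $$ (i, i))"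
    using similar_mat_witD2(3)[OF pow_carrier_mat[OF A] similar_mat_wit_pow[OF wit]] by metis
  also have "\<dots> = (\<Sum>i<n. (Q * (P * B ^\<^sub>m k)) $$ (i, i))"
    using PQ Bk by (intro trace_mult_commute) auto
  also have "Q * (P * B ^\<^sub>m k) = B ^\<^sub>m k"
    using PQ Bk by (simp only: assoc_mult_mat[OF PQ(2,1) Bk, symmetric] PQ(3) left_mult_one_mat[OF Bk])
  also have "(\<Sum>i<n. (B ^\<^sub>m k) $$ (i, i)) = (\<Sum>i<n. (B $$ (i, i)) ^ k)"
    using upper_triangular_pow_mat[OF B ut, of k] by (intro sum.cong) auto
  also have "\<dots> = (\<Sum>z\<leftarrow>es. z ^ k)"
    using B by (simp add: sum_list_sum_nth atLeast0LessThan flip: diag) (simp add: diag_mat_def)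
  also have "\<dots> = (\<Sum>z\<in>#eigenvalue_mset A. z ^ k)"
    by (simp flip: es mset_map sum_mset_sum_list)
  finally show ?thesis ..
qed

text \<open>
  The eigenvalue equation is read off at a coordinate where the eigenvector has largest modulus.
\<close>

lemma eigenvalue_cmod_le_row_sum:
  fixes A :: "complex mat"
  assumes A: "A \<in> carrier_mat n n" and ev: "eigenvalue A z"
    and row: "\<And>i. i < n \<Longrightarrow> (\<Sum>j<n. cmod (A $$ (i, j))) \<le> R"
  shows "cmod z \<le> R"
proof -
  obtain v where v: "v \<in> carrier_vec n" "v \<noteq> 0\<^sub>v n" and Av: "A *\<^sub>v v = z \<cdot>\<^sub>v v"
    using ev A by (auto simp: eigenvalue_def eigenvector_def)
  have "\<exists>i0<n. v $ i0 \<noteq> 0"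
  proof (rule ccontr)
    assume "\<not> ?thesis"
    then have "v = 0\<^sub>v n" using v by (intro eq_vecI) auto
    then show False using v by simp
  qed
  then obtain i0 where i0: "i0 < n" "v $ i0 \<noteq> 0" by blast
  define m where "m = Max ((\<lambda>i. cmod (v $ i)) ` {..<n})"
  have "m \<in> (\<lambda>i. cmod (v $ i)) ` {..<n}"
    unfolding m_def using i0 by (intro Max_in) auto
  then obtain i where i: "i < n" "m = cmod (v $ i)" by auto
  have le: "cmod (v $ j) \<le> cmod (v $ i)" if "j < n" for j
    using that unfolding i(2)[symmetric] m_def by (intro Max_ge) auto
  have pos: "0 < cmod (v $ i)"
    using le[OF i0(1)] i0(2) by (smt (verit) zero_less_norm_iff)
  have "z * v $ i = (A *\<^sub>v v) $ i"
    using Av v i by simp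
  also have "\<dots> = (\<Sum>j<n. A $$ (i, j) * v $ j)"
    using A v i by (simp add: scalar_prod_def atLeast0LessThan)
  finally have "cmod z * cmod (v $ i) = cmod (\<Sum>j<n. A $$ (i, j) * v $ j)"
    by (metis norm_mult)
  also have "\<dots> \<le> (\<Sum>j<n. cmod (A $$ (i, j)) * cmod (v $ j))"
    by (rule order_trans[OF norm_sum]) (simp add: norm_mult)
  also have "\<dots> \<le> (\<Sum>j<n. cmod (A $$ (i, j)) * cmod (v $ i))"
    by (intro sum_mono mult_left_mono le) auto
  also have "\<dots> \<le> R * cmod (v $ i)"
    using row[OF i(1)] by (simp flip: sum_distrib_right add: mult_right_mono)
  finally show ?thesis using pos by simp
qed

lemma pow_mat_row_sum_le:
  fixes A :: "complex mat"
  assumes A: "A \<in> carrier_mat n n"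
    and row: "\<And>i. i < n \<Longrightarrow> (\<Sum>j<n. cmod (A $$ (i, j))) \<le> R" and "i < n"
  shows "(\<Sum>j<n. cmod ((A ^\<^sub>m k) $$ (i, j))) \<le> R ^ k"
proof (induction k)
  case 0
  have "(\<Sum>j<n. cmod ((A ^\<^sub>m 0) $$ (i, j))) = (\<Sum>j<n. if j = i then 1 else 0)"
    using A \<open>i < n\<close> by (intro sum.cong) auto
  then show ?case using \<open>i < n\<close> by simp
next
  case (Suc k)
  have R: "0 \<le> R"
    using row[OF \<open>i < n\<close>] by (rule order_trans[rotated]) (auto intro: sum_nonneg)
  have Ak: "A ^\<^sub>m k \<in> carrier_mat n n"
    using A by (rule pow_carrier_mat)
  have "(\<Sum>j<n. cmod ((A ^\<^sub>m Suc k) $$ (i, j))) = (\<Sum>j<n. cmod (\<Sum>l<n. (A ^\<^sub>m k) $$ (i, l) * A $$ (l, j)))"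
    using A Ak \<open>i < n\<close> by (simp add: scalar_prod_def atLeast0LessThan)
  also have "\<dots> \<le> (\<Sum>j<n. \<Sum>l<n. cmod ((A ^\<^sub>m k) $$ (i, l)) * cmod (A $$ (l, j)))"
    by (intro sum_mono order_trans[OF norm_sum]) (simp add: norm_mult)
  also have "\<dots> = (\<Sum>l<n. cmod ((A ^\<^sub>m k) $$ (i, l)) * (\<Sum>j<n. cmod (A $$ (l, j))))"
    by (subst sum.swap) (simp add: sum_distrib_left)
  also have "\<dots> \<le> (\<Sum>l<n. cmod ((A ^\<^sub>m k) $$ (i, l)) * R)"
    using row by (intro sum_mono mult_left_mono) auto
  also have "\<dots> \<le> R ^ k * R"
    using Suc R by (simp flip: sum_distrib_right add: mult_right_mono)
  finally show ?case by (simp add: mult.commute)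
qed

section \<open>Measurability of the number of eigenvalues in a closed set\<close>

text \<open>
  Tuples of \<open>n\<close> roots are encoded as sequences, so that the product topology on functions applies
  for every \<open>n\<close>; the entries from \<open>n\<close> on only have to stay in the disc. The set is a finite union of
  products of compact sets, one for each choice of the indices that are required to lie in \<open>S\<close>.
\<close>

lemma compact_root_tuples:
  fixes S :: "complex set"
  assumes "closed S"
  shows "compact {x :: nat \<Rightarrow> complex. (\<forall>i. cmod (x i) \<le> R) \<and> m \<le> card {i \<in> {..<n}. x i \<in> S}}"
proof -
  let ?F = "{T. T \<subseteq> {..<n} \<and> m \<le> card T}"
  let ?box = "\<lambda>T :: nat set. \<Pi>\<^sub>E i\<in>UNIV. if i \<in> T then cball 0 R \<inter> S else cball 0 R"
  have "compactin (product_topology (\<lambda>_. euclidean) (UNIV :: nat set)) (?box T)" for T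
    unfolding compactin_PiE using assms by (auto intro: compact_Int_closed)
  then have "compact (?box T)" for T
    by (simp add: euclidean_product_topology)
  moreover have "finite ?F" by simp
  ultimately have "compact (\<Union>T\<in>?F. ?box T)"
    by blast
  also have "(\<Union>T\<in>?F. ?box T) = {x. (\<forall>i. cmod (x i) \<le> R) \<and> m \<le> card {i \<in> {..<n}. x i \<in> S}}"
  proof (intro Set.set_eqI iffI)
    fix x assume "x \<in> (\<Union>T\<in>?F. ?box T)"
    then obtain T where T: "T \<subseteq> {..<n}" "m \<le> card T" and x: "\<And>i. x i \<in> (if i \<in> T then cball 0 R \<inter> S else cball 0 R)"
      by (auto simp: PiE_iff)
    have "x i \<in> cball 0 R \<and> (i \<in> T \<longrightarrow> x i \<in> S)" for i
      using x[of i] by (auto split: if_splits)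
    moreover from this have "card T \<le> card {i \<in> {..<n}. x i \<in> S}"
      using T by (intro card_mono) auto
    ultimately show "x \<in> {x. (\<forall>i. cmod (x i) \<le> R) \<and> m \<le> card {i \<in> {..<n}. x i \<in> S}}"
      using T by auto
  next
    fix x assume "x \<in> {x. (\<forall>i. cmod (x i) \<le> R) \<and> m \<le> card {i \<in> {..<n}. x i \<in> S}}"
    then show "x \<in> (\<Union>T\<in>?F. ?box T)"
      by (intro UN_I[of "{i \<in> {..<n}. x i \<in> S}"]) (auto simp: PiE_iff)
  qed
  finally show ?thesis .
qed

text \<open>
  A polynomial is encoded below by its sequence of values at the natural numbers. This makes the
  passage from roots to polynomials visibly continuous and the passage from a matrix to its
  characteristic polynomial visibly measurable.
\<close>

lemma poly_eqI_nat:
  fixes p q :: "'a::{idom, ring_char_0} poly"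
  assumes "\<And>k::nat. poly p (of_nat k) = poly q (of_nat k)"
  shows "p = q"
proof (rule ccontr)
  assume "p \<noteq> q"
  then have "finite {x. poly (p - q) x = 0}"
    by (intro poly_roots_finite) simp
  moreover have "range of_nat \<subseteq> {x. poly (p - q) x = 0}"
    using assms by auto
  ultimately have "finite (range (of_nat :: nat \<Rightarrow> 'a))"
    by (rule finite_subset[rotated])
  moreover have "infinite (range (of_nat :: nat \<Rightarrow> 'a))"
    by (intro range_inj_infinite injI) simp
  ultimately show False
    by contradiction
qed

lemma borel_measurable_poly_char_poly:
  fixes A :: "'w \<Rightarrow> complex mat"
  assumes carr: "\<And>\<omega>. A \<omega> \<in> carrier_mat n n"
    and meas: "\<And>i j. i < n \<Longrightarrow> j < n \<Longrightarrow> (\<lambda>\<omega>. A \<omega> $$ (i, j)) \<in> borel_measurable M"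
  shows "(\<lambda>\<omega>. poly (char_poly (A \<omega>)) z) \<in> borel_measurable M"
proof -
  have "poly (char_poly (A \<omega>)) z = (\<Sum>f | f permutes {0..<n}.
      signof f * (\<Prod>i = 0..<n. (if i = f i then z else 0) - A \<omega> $$ (i, f i)))" for \<omega>
  proof -
    have "poly (char_poly (A \<omega>)) z = (\<Sum>f | f permutes {0..<n}.
        signof f * (\<Prod>i = 0..<n. (- char_matrix (A \<omega>) z) $$ (i, f i)))"
      unfolding char_poly_matrix[OF carr] by (rule det_def') (use carr in auto)
    also have "\<dots> = (\<Sum>f | f permutes {0..<n}.
        signof f * (\<Prod>i = 0..<n. (if i = f i then z else 0) - A \<omega> $$ (i, f i)))"
      using carr[of \<omega>]
      by (intro sum.cong arg_cong2[where f = "(*)"] prod.cong refl)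
        (auto simp: char_matrix_def dest: permutes_in_image)
    finally show ?thesis .
  qed
  moreover have "(\<lambda>\<omega>. A \<omega> $$ (i, f i)) \<in> borel_measurable M"
    if "f permutes {0..<n}" "i \<in> {0..<n}" for f i
    using that permutes_in_image[OF that(1), of i] by (intro meas) auto
  ultimately show ?thesis
    by (simp only:, intro borel_measurable_sum borel_measurable_times borel_measurable_prod
        borel_measurable_diff borel_measurable_const) auto
qed

text \<open>
  With \<open>K\<close> the compact set of root tuples that have at least \<open>m\<close> entries in \<open>S\<close>, \<open>\<Phi>\<close> the passage from
  roots to polynomials and \<open>\<Psi>\<close> the characteristic polynomial, the event is the preimage under \<open>\<Psi>\<close> of the
  compact, hence closed, set \<open>\<Phi> ` K\<close>. The bound on the eigenvalues is what makes \<open>K\<close> compact.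
\<close>

lemma sets_eigenvalue_count_ge:
  fixes A :: "'w \<Rightarrow> complex mat"
  assumes carr: "\<And>\<omega>. A \<omega> \<in> carrier_mat n n"
    and meas: "\<And>i j. i < n \<Longrightarrow> j < n \<Longrightarrow> (\<lambda>\<omega>. A \<omega> $$ (i, j)) \<in> borel_measurable M"
    and bounded: "\<And>\<omega> z. \<omega> \<in> space M \<Longrightarrow> eigenvalue (A \<omega>) z \<Longrightarrow> cmod z \<le> R"
    and "0 \<le> R" "closed S"
  shows "{\<omega> \<in> space M. m \<le> size {#z \<in># eigenvalue_mset (A \<omega>). z \<in> S#}} \<in> sets M"
proof -
  define K where "K = {x :: nat \<Rightarrow> complex. (\<forall>i. cmod (x i) \<le> R) \<and> m \<le> card {i \<in> {..<n}. x i \<in> S}}"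
  define \<Phi> where "\<Phi> = (\<lambda>(x :: nat \<Rightarrow> complex) (k :: nat). \<Prod>i<n. of_nat k - x i)"
  define \<Psi> where "\<Psi> = (\<lambda>\<omega> (k :: nat). poly (char_poly (A \<omega>)) (of_nat k))"
  have count: "size {#z \<in># image_mset x (mset_set {..<n}). z \<in> S#} = card {i \<in> {..<n}. x i \<in> S}" for x
    by (simp add: filter_mset_image_mset)
  have prod: "poly (\<Prod>z\<in>#image_mset x (mset_set {..<n}). [:-z, 1:]) (of_nat k) = \<Phi> x k" for x k
    by (simp add: \<Phi>_def poly_prod image_mset.compositionality o_def flip: prod_unfold_prod_mset)
  have "m \<le> size {#z \<in># eigenvalue_mset (A \<omega>). z \<in> S#} \<longleftrightarrow> \<Psi> \<omega> \<in> \<Phi> ` K" if "\<omega> \<in> space M" for \<omega>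
  proof
    assume *: "m \<le> size {#z \<in># eigenvalue_mset (A \<omega>). z \<in> S#}"
    obtain es where es: "mset es = eigenvalue_mset (A \<omega>)"
      using ex_mset by blast
    have len: "length es = n"
      using size_eigenvalue_mset[OF carr, of \<omega>] by (simp flip: es)
    define x where "x = (\<lambda>i. if i < n then es ! i else 0)"
    have "mset es = image_mset ((!) es) (mset_set {..<n})"
      by (metis len map_nth mset_map mset_upt atLeast0LessThan)
    then have x: "eigenvalue_mset (A \<omega>) = image_mset x (mset_set {..<n})"
      unfolding es[symmetric] by (auto simp: x_def intro!: image_mset_cong)
    have "cmod (x i) \<le> R" for i
    proof (cases "i < n")
      case True
      then have "x i \<in># eigenvalue_mset (A \<omega>)" unfolding x by auto
      then show ?thesis
        using bounded[OF that] set_eigenvalue_mset[OF carr] by blast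
    qed (use \<open>0 \<le> R\<close> in \<open>simp add: x_def\<close>)
    then have "x \<in> K"
      using * by (simp add: K_def x count)
    moreover have "\<Psi> \<omega> = \<Phi> x"
      unfolding \<Psi>_def char_poly_eigenvalue_mset[OF carr] x prod ..
    ultimately show "\<Psi> \<omega> \<in> \<Phi> ` K" by blast
  next
    assume "\<Psi> \<omega> \<in> \<Phi> ` K"
    then obtain x where x: "x \<in> K" "\<Psi> \<omega> = \<Phi> x" by blast
    have "char_poly (A \<omega>) = (\<Prod>z\<in>#image_mset x (mset_set {..<n}). [:-z, 1:])"
      using fun_cong[OF x(2)] by (intro poly_eqI_nat) (simp only: prod, simp add: \<Psi>_def)
    then have "eigenvalue_mset (A \<omega>) = image_mset x (mset_set {..<n})"
      by (simp only: eigenvalue_mset_def proots_prod_mset_linear)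
    then show "m \<le> size {#z \<in># eigenvalue_mset (A \<omega>). z \<in> S#}"
      using x(1) by (simp only: count) (simp add: K_def)
  qed
  then have "{\<omega> \<in> space M. m \<le> size {#z \<in># eigenvalue_mset (A \<omega>). z \<in> S#}} = \<Psi> -` (\<Phi> ` K) \<inter> space M"
    by blast
  moreover have "continuous_on UNIV \<Phi>"
    unfolding \<Phi>_def
    by (intro continuous_on_coordinatewise_then_product continuous_intros continuous_on_product_coordinates)
  then have "compact (\<Phi> ` K)"
    using compact_root_tuples[OF \<open>closed S\<close>, of R m n] unfolding K_def[symmetric]
    by (intro compact_continuous_image) (auto intro: continuous_on_subset)
  then have "\<Phi> ` K \<in> sets borel"
    by (intro borel_closed compact_imp_closed)
  moreover have "\<Psi> \<in> borel_measurable M"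
    unfolding \<Psi>_def
    by (intro measurable_coordinatewise_then_product borel_measurable_poly_char_poly[where n=n] carr meas)
  ultimately show ?thesis
    by (simp only: measurable_sets)
qed

lemma eigenvalue_count_measurable:
  fixes A :: "'w \<Rightarrow> complex mat"
  assumes carr: "\<And>\<omega>. A \<omega> \<in> carrier_mat n n"
    and meas: "\<And>i j. i < n \<Longrightarrow> j < n \<Longrightarrow> (\<lambda>\<omega>. A \<omega> $$ (i, j)) \<in> borel_measurable M"
    and bounded: "\<And>\<omega> z. \<omega> \<in> space M \<Longrightarrow> eigenvalue (A \<omega>) z \<Longrightarrow> cmod z \<le> R"
    and "0 \<le> R" "closed S"
  shows "(\<lambda>\<omega>. size {#z \<in># eigenvalue_mset (A \<omega>). z \<in> S#}) \<in> measurable M (count_space UNIV)"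
proof -
  have "{\<omega> \<in> space M. size {#z \<in># eigenvalue_mset (A \<omega>). z \<in> S#} = m} =
     {\<omega> \<in> space M. m \<le> size {#z \<in># eigenvalue_mset (A \<omega>). z \<in> S#}} -
     {\<omega> \<in> space M. Suc m \<le> size {#z \<in># eigenvalue_mset (A \<omega>). z \<in> S#}}" for m
    by auto
  then have "{\<omega> \<in> space M. size {#z \<in># eigenvalue_mset (A \<omega>). z \<in> S#} = m} \<in> sets M" for m
    by (simp only: sets.Diff sets_eigenvalue_count_ge[OF assms])
  moreover have "(\<lambda>\<omega>. size {#z \<in># eigenvalue_mset (A \<omega>). z \<in> S#}) -` {m} \<inter> space M =
     {\<omega> \<in> space M. size {#z \<in># eigenvalue_mset (A \<omega>). z \<in> S#} = m}" for m
    by auto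
  ultimately show ?thesis
    by (subst measurable_count_space_eq2_countable) auto
qed

section \<open>The empirical spectral measure as a kernel and its mean\<close>

lemma sum_mset_indicator:
  "(\<Sum>z\<in>#X. indicator S z :: ennreal) = of_nat (size {#z \<in># X. z \<in> S#})"
  by (induction X) (auto simp: indicator_def)

lemma measurable_empirical_spectral_measure:
  fixes A :: "'w \<Rightarrow> complex mat"
  assumes carr: "\<And>\<omega>. A \<omega> \<in> carrier_mat n n"
    and meas: "\<And>i j. i < n \<Longrightarrow> j < n \<Longrightarrow> (\<lambda>\<omega>. A \<omega> $$ (i, j)) \<in> borel_measurable M"
    and bounded: "\<And>\<omega> z. \<omega> \<in> space M \<Longrightarrow> eigenvalue (A \<omega>) z \<Longrightarrow> cmod z \<le> R"
    and "0 \<le> R" and prob: "\<And>\<omega>. prob_space (empirical_spectral_measure (A \<omega>))"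
  shows "(\<lambda>\<omega>. empirical_spectral_measure (A \<omega>)) \<in> measurable M (subprob_algebra borel)"
proof (rule measurable_subprob_algebra_generated)
  show "sets borel = sigma_sets UNIV (Collect closed :: complex set set)"
    by (metis borel_eq_closed sets_measure_of subset_UNIV Pow_UNIV)
  show "Int_stable (Collect closed :: complex set set)"
    by (auto simp: Int_stable_def)
  have *: "(\<lambda>\<omega>. emeasure (empirical_spectral_measure (A \<omega>)) S) \<in> borel_measurable M" if "closed S" for S
  proof -
    note [measurable] = eigenvalue_count_measurable[OF assms(1-4) that]
    have "emeasure (empirical_spectral_measure (A \<omega>)) S =
        of_nat (size {#z \<in># eigenvalue_mset (A \<omega>). z \<in> S#}) / of_nat n" for \<omega>
      using carr[of \<omega>] that
      by (subst emeasure_empirical_spectral_measure) (auto simp: sum_mset_indicator)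
    then show ?thesis by simp
  qed
  then show "S \<in> Collect closed \<Longrightarrow> (\<lambda>\<omega>. emeasure (empirical_spectral_measure (A \<omega>)) S) \<in> borel_measurable M" for S
    by simp
  show "(\<lambda>\<omega>. emeasure (empirical_spectral_measure (A \<omega>)) UNIV) \<in> borel_measurable M"
    by (intro *) simp
qed (use prob prob_space_imp_subprob_space in auto)

text \<open>
  Choosing an enumeration of the eigenvalues turns integrals against the empirical spectral measure
  into finite averages.
\<close>

lemma empirical_spectral_measure_eq_distr:
  assumes A: "A \<in> carrier_mat n n" "0 < n" and es: "mset es = eigenvalue_mset A"
  shows "empirical_spectral_measure A = distr (uniform_count_measure {..<n}) borel ((!) es)"
proof (rule measure_eqI)
  fix B assume "B \<in> sets (empirical_spectral_measure A)"
  then have B: "B \<in> sets borel" by simp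
  have len: "length es = n"
    using size_eigenvalue_mset[OF A(1)] by (simp flip: es)
  have meas: "(!) es \<in> measurable (uniform_count_measure {..<n}) borel"
    by (auto simp: measurable_def sets_uniform_count_measure space_uniform_count_measure)
  have sp: "(!) es -` B \<inter> {..<n} = {i \<in> {..<n}. es ! i \<in> B}"
    by auto
  have "size {#z \<in># eigenvalue_mset A. z \<in> B#} = card {i \<in> {..<n}. es ! i \<in> B}"
    unfolding es[symmetric] by (simp add: length_filter_conv_card len flip: mset_filter)
  moreover have "emeasure (uniform_count_measure {..<n}) {i \<in> {..<n}. es ! i \<in> B} =
      card {i \<in> {..<n}. es ! i \<in> B} / card {..<n}"
    by (rule emeasure_uniform_count_measure) auto
  ultimately show "emeasure (empirical_spectral_measure A) B =
      emeasure (distr (uniform_count_measure {..<n}) borel ((!) es)) B"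
    using A B unfolding emeasure_distr[OF meas B] space_uniform_count_measure sp
    by (simp add: emeasure_empirical_spectral_measure sum_mset_indicator ennreal_of_nat_eq_real_of_nat
        divide_ennreal)
qed simp

lemma prob_space_empirical_spectral_measure:
  assumes A: "A \<in> carrier_mat n n" "0 < n"
  shows "prob_space (empirical_spectral_measure A)"
proof -
  obtain es where es: "mset es = eigenvalue_mset A"
    using ex_mset by blast
  interpret prob_space "uniform_count_measure {..<n}"
    using \<open>0 < n\<close> by (intro prob_space_uniform_count_measure) auto
  show ?thesis
    unfolding empirical_spectral_measure_eq_distr[OF A es]
    by (intro prob_space_distr) (auto simp: measurable_def sets_uniform_count_measure space_uniform_count_measure)
qed

lemma integral_empirical_spectral_measure:
  fixes f :: "complex \<Rightarrow> real"
  assumes A: "A \<in> carrier_mat n n" "0 < n" and f: "f \<in> borel_measurable borel"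
  shows "(\<integral>z. f z \<partial>empirical_spectral_measure A) = (\<Sum>z\<in>#eigenvalue_mset A. f z) / n"
proof -
  obtain es where es: "mset es = eigenvalue_mset A"
    using ex_mset by blast
  have len: "length es = n"
    using size_eigenvalue_mset[OF A(1)] by (simp flip: es)
  have "(\<integral>z. f z \<partial>empirical_spectral_measure A) = (\<integral>i. f (es ! i) \<partial>uniform_count_measure {..<n})"
    unfolding empirical_spectral_measure_eq_distr[OF A es]
    by (rule integral_distr[OF _ f]) (auto simp: measurable_def sets_uniform_count_measure space_uniform_count_measure)
  also have "\<dots> = (\<Sum>i<n. f (es ! i)) / n"
    by (simp add: integral_uniform_count_measure)
  also have "(\<Sum>i<n. f (es ! i)) = (\<Sum>z\<in>#eigenvalue_mset A. f z)"
    by (simp add: sum_mset_sum_list sum_list_sum_nth len atLeast0LessThan flip: es mset_map)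
  finally show ?thesis .
qed

text \<open>
  The indicator of a closed set \<open>C\<close> is the bounded pointwise limit of the continuous functions
  \<open>max 0 (1 - k * infdist x C)\<close>, and the closed sets generate the Borel sets.
\<close>

lemma measure_eq_of_integral_continuous_eq:
  fixes \<nu>1 \<nu>2 :: "'a::metric_space measure"
  assumes "prob_space \<nu>1" "sets \<nu>1 = sets borel" "prob_space \<nu>2" "sets \<nu>2 = sets borel"
    and eq: "\<And>f :: 'a \<Rightarrow> real. continuous_on UNIV f \<Longrightarrow> integral\<^sup>L \<nu>1 f = integral\<^sup>L \<nu>2 f"
  shows "\<nu>1 = \<nu>2"
proof -
  have lim: "(\<lambda>k. integral\<^sup>L \<nu> (\<lambda>x. max 0 (1 - real k * infdist x C))) \<longlonglongrightarrow> measure \<nu> C"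
    if "prob_space \<nu>" and sets: "sets \<nu> = sets borel" and C: "closed C" "C \<noteq> {}" for C and \<nu> :: "'a measure"
  proof -
    interpret prob_space \<nu> by fact
    note [measurable_cong] = sets
    have [measurable]: "C \<in> sets \<nu>"
      using C sets by simp
    have "(\<lambda>x. max 0 (1 - real k * infdist x C)) \<in> borel_measurable \<nu>" for k
      unfolding measurable_cong_sets[OF sets refl]
      by (intro borel_measurable_continuous_onI continuous_intros)
    moreover have "(\<lambda>k. max 0 (1 - real k * infdist x C)) \<longlonglongrightarrow> indicator C x" for x
    proof (cases "x \<in> C")
      case True
      then show ?thesis by simp
    next
      case False
      then have pos: "0 < infdist x C"
        using in_closed_iff_infdist_zero[OF C] infdist_nonneg[of x C] by (auto simp: less_le)
      have "eventually (\<lambda>k. 1 / infdist x C < real k) sequentially"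
        using filterlim_real_sequentially unfolding filterlim_at_top_dense by blast
      then have "eventually (\<lambda>k. max 0 (1 - real k * infdist x C) = 0) sequentially"
        by eventually_elim (use pos in \<open>simp add: field_simps\<close>)
      then show ?thesis
        using False by (simp add: tendsto_eventually)
    qed
    ultimately have "(\<lambda>k. integral\<^sup>L \<nu> (\<lambda>x. max 0 (1 - real k * infdist x C))) \<longlonglongrightarrow> integral\<^sup>L \<nu> (indicator C)"
      by (intro integral_dominated_convergence[where w = "\<lambda>_. 1"]) (auto simp: infdist_nonneg)
    then show ?thesis by simp
  qed
  have closed_eq: "emeasure \<nu>1 C = emeasure \<nu>2 C" if "closed C" for C
  proof (cases "C = {}")
    case False
    have "(\<lambda>k. integral\<^sup>L \<nu>1 (\<lambda>x. max 0 (1 - real k * infdist x C))) =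
        (\<lambda>k. integral\<^sup>L \<nu>2 (\<lambda>x. max 0 (1 - real k * infdist x C)))"
      by (intro ext eq continuous_intros)
    then have "measure \<nu>1 C = measure \<nu>2 C"
      using lim[OF assms(1,2) that False] lim[OF assms(3,4) that False] LIMSEQ_unique by metis
    then show ?thesis
      using assms by (simp add: finite_measure.emeasure_eq_measure prob_space.finite_measure)
  qed simp
  show ?thesis
  proof (rule measure_eqI_generator_eq[where E = "Collect closed" and \<Omega> = UNIV and A = "\<lambda>_. UNIV"])
    have "sets borel = sigma_sets UNIV (Collect closed :: 'a set set)"
      by (subst borel_eq_closed) simp
    then show "sets \<nu>1 = sigma_sets UNIV (Collect closed)" "sets \<nu>2 = sigma_sets UNIV (Collect closed)"
      using assms by auto
    show "emeasure \<nu>1 UNIV \<noteq> \<infinity>" for i :: nat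
      using assms by (simp add: finite_measure.emeasure_eq_measure prob_space.finite_measure)
  qed (auto simp: Int_stable_def closed_eq)
qed

lemma is_mean_measure_unique:
  assumes "is_mean_measure M \<sigma> \<nu>1" "is_mean_measure M \<sigma> \<nu>2"
  shows "\<nu>1 = \<nu>2"
  using assms unfolding is_mean_measure_def by (intro measure_eq_of_integral_continuous_eq) auto

text \<open>
  The defining property of the mean measure quantifies over all continuous functions, while the
  integral against a composition with a kernel is an iterated integral for bounded ones. Both sides only see the
  values of the function on the disc that contains the eigenvalues, so it may be cut off
  outside. The second part lets properties of the eigenvalues that hold almost surely pass to
  the mean measure.
\<close>

lemma bind_empirical:
  fixes A :: "'w \<Rightarrow> complex mat"
  assumes M: "prob_space M" and n: "0 < n"
    and carr: "\<And>\<omega>. A \<omega> \<in> carrier_mat n n"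
    and meas: "\<And>i j. i < n \<Longrightarrow> j < n \<Longrightarrow> (\<lambda>\<omega>. A \<omega> $$ (i, j)) \<in> borel_measurable M"
    and bounded: "\<And>\<omega> z. \<omega> \<in> space M \<Longrightarrow> eigenvalue (A \<omega>) z \<Longrightarrow> cmod z \<le> R"
    and R: "0 \<le> R"
  defines "\<sigma> \<equiv> \<lambda>\<omega>. empirical_spectral_measure (A \<omega>)"
  shows is_mean_measure_bind_empirical: "is_mean_measure M \<sigma> (M \<bind> \<sigma>)"
    and AE_bind_empirical: "\<And>S. closed S \<Longrightarrow> AE \<omega> in M. \<forall>z. eigenvalue (A \<omega>) z \<longrightarrow> z \<in> S \<Longrightarrow>
      AE z in M \<bind> \<sigma>. z \<in> S"
proof -
  interpret M: prob_space M by fact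
  have \<sigma>[measurable]: "\<sigma> \<in> measurable M (subprob_algebra borel)"
    unfolding \<sigma>_def
    by (rule measurable_empirical_spectral_measure[OF carr meas bounded R prob_space_empirical_spectral_measure[OF carr n]])
  have prob: "prob_space (\<sigma> \<omega>)" for \<omega>
    unfolding \<sigma>_def by (rule prob_space_empirical_spectral_measure[OF carr n])
  have ne: "space M \<noteq> {}" by (rule M.not_empty)
  have prob_bind: "prob_space (M \<bind> \<sigma>)"
    using prob by (intro M.prob_space_bind[OF _ \<sigma>]) auto
  have sets_bind: "sets (M \<bind> \<sigma>) = sets borel"
    by (rule sets_bind[OF _ ne]) (simp add: \<sigma>_def)
  have AE_S: "AE z in M \<bind> \<sigma>. z \<in> S"
    if S: "closed S" and ev: "AE \<omega> in M. \<forall>z. eigenvalue (A \<omega>) z \<longrightarrow> z \<in> S" for S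
  proof -
    have "emeasure (\<sigma> \<omega>) (- S) = 0" if "\<forall>z. eigenvalue (A \<omega>) z \<longrightarrow> z \<in> S" for \<omega>
    proof -
      have "{#z \<in># eigenvalue_mset (A \<omega>). z \<in> - S#} = {#}"
        using that set_eigenvalue_mset[OF carr, of _ \<omega>]
        by (subst filter_mset_cong[OF refl, where g = "\<lambda>_. False"]) auto
      then show ?thesis
        using carr[of \<omega>] n S unfolding \<sigma>_def
        by (subst emeasure_empirical_spectral_measure) (simp_all only: sum_mset_indicator, auto)
    qed
    then have "AE \<omega> in M. emeasure (\<sigma> \<omega>) (- S) = 0"
      using ev by (auto elim!: eventually_mono)
    then have "(\<integral>\<^sup>+\<omega>. emeasure (\<sigma> \<omega>) (- S) \<partial>M) = (\<integral>\<^sup>+\<omega>. 0 \<partial>M)"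
      by (rule nn_integral_cong_AE)
    moreover have "emeasure (M \<bind> \<sigma>) (- S) = (\<integral>\<^sup>+\<omega>. emeasure (\<sigma> \<omega>) (- S) \<partial>M)"
      using S by (intro emeasure_bind[OF ne \<sigma>]) auto
    ultimately show ?thesis
      using S by (intro AE_I[where N = "- S"]) (auto simp: sets_bind)
  qed
  then show "\<And>S. closed S \<Longrightarrow> AE \<omega> in M. \<forall>z. eigenvalue (A \<omega>) z \<longrightarrow> z \<in> S \<Longrightarrow> AE z in M \<bind> \<sigma>. z \<in> S"
    by blast
  have null: "AE z in M \<bind> \<sigma>. z \<in> cball 0 R"
    using bounded by (intro AE_S) auto
  have "integral\<^sup>L (M \<bind> \<sigma>) f = (\<integral>\<omega>. integral\<^sup>L (\<sigma> \<omega>) f \<partial>M)" if f: "continuous_on UNIV f" for f :: "complex \<Rightarrow> real"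
  proof -
    define g where "g = (\<lambda>z. indicator (cball 0 R) z * f z)"
    have fm: "f \<in> borel_measurable borel"
      using f by (rule borel_measurable_continuous_onI)
    have g[measurable]: "g \<in> borel_measurable borel"
      unfolding g_def by (intro borel_measurable_times borel_measurable_indicator fm borel_closed) simp
    have "bounded (f ` cball 0 R)"
      using f by (intro compact_imp_bounded compact_continuous_image) (auto intro: continuous_on_subset)
    then obtain B where "\<forall>y\<in>f ` cball 0 R. norm y \<le> B"
      unfolding bounded_iff by blast
    then have B: "\<bar>f z\<bar> \<le> B" if "z \<in> cball 0 R" for z
      using that by simp
    have "0 \<le> B" using B[of 0] R by auto
    then have gB: "\<bar>g z\<bar> \<le> B" for z
      using B by (auto simp: g_def indicator_def)
    have "integral\<^sup>L (M \<bind> \<sigma>) f = integral\<^sup>L (M \<bind> \<sigma>) g"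
      unfolding g_def using null
      by (intro integral_cong_AE) (auto simp: measurable_cong_sets[OF sets_bind refl] fm g[unfolded g_def] elim!: eventually_mono)
    also have "\<dots> = (\<integral>\<omega>. integral\<^sup>L (\<sigma> \<omega>) g \<partial>M)"
      by (intro integral_bind[OF g gB \<sigma> M.finite_measure_axioms, where B' = 1] AE_I2)
        (simp add: prob_space.emeasure_space_1[OF prob])
    also have "\<dots> = (\<integral>\<omega>. integral\<^sup>L (\<sigma> \<omega>) f \<partial>M)"
    proof (rule Bochner_Integration.integral_cong[OF refl])
      fix \<omega> assume \<omega>: "\<omega> \<in> space M"
      have "(\<Sum>z\<in>#eigenvalue_mset (A \<omega>). g z) = (\<Sum>z\<in>#eigenvalue_mset (A \<omega>). f z)"
        using bounded[OF \<omega>] set_eigenvalue_mset[OF carr, of _ \<omega>]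
        by (intro arg_cong[where f = sum_mset] image_mset_cong) (auto simp: g_def indicator_def)
      then show "integral\<^sup>L (\<sigma> \<omega>) g = integral\<^sup>L (\<sigma> \<omega>) f"
        unfolding \<sigma>_def by (simp add: integral_empirical_spectral_measure[OF carr n] fm)
    qed
    finally show ?thesis .
  qed
  then show "is_mean_measure M \<sigma> (M \<bind> \<sigma>)"
    using prob_bind sets_bind by (simp add: is_mean_measure_def)
qed


lemma mean_measure_eq:
  assumes "is_mean_measure M \<sigma> \<nu>"
  shows "mean_measure M \<sigma> = \<nu>"
  unfolding mean_measure_def using assms is_mean_measure_unique by (intro the_equality) auto

section \<open>Powers of banded Hessenberg matrices and shift invariance\<close>

text \<open>
  The entries do not depend on the size of the matrix, so all \<open>banded_hessenberg p b n\<close> are corners of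
  one infinite matrix. The finite sum \<open>walk_sum p b k i j\<close> below is the entry \<open>(i, j)\<close> of its \<open>k\<close>-th power:
  a walk of length \<open>k\<close> from \<open>i\<close> does not go beyond \<open>i + k\<close>.
\<close>

definition hess_entry :: "nat \<Rightarrow> (nat \<Rightarrow> nat \<Rightarrow> complex) \<Rightarrow> nat \<Rightarrow> nat \<Rightarrow> complex" where
  "hess_entry p b i j = (if j = i + 1 then 1 else if j \<le> i \<and> i \<le> j + p then b (i - j) (j + 1) else 0)"

primrec walk_sum :: "nat \<Rightarrow> (nat \<Rightarrow> nat \<Rightarrow> complex) \<Rightarrow> nat \<Rightarrow> nat \<Rightarrow> nat \<Rightarrow> complex" where
  "walk_sum p b 0 i j = (if i = j then 1 else 0)"
| "walk_sum p b (Suc k) i j = (\<Sum>l\<le>i + k. walk_sum p b k i l * hess_entry p b l j)"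

lemma banded_hessenberg_carrier: "banded_hessenberg p b n \<in> carrier_mat n n"
  by (simp add: banded_hessenberg_def)

lemma banded_hessenberg_entry:
  "i < n \<Longrightarrow> j < n \<Longrightarrow> banded_hessenberg p b n $$ (i, j) = hess_entry p b i j"
  by (simp add: banded_hessenberg_def hess_entry_def)

lemma walk_sum_above: "i + k < j \<Longrightarrow> walk_sum p b k i j = 0"
  by (cases k) (auto simp: hess_entry_def intro!: sum.neutral)

lemma walk_sum_below: "j + k * p < i \<Longrightarrow> walk_sum p b k i j = 0"
proof (induction k arbitrary: j)
  case (Suc k)
  have "walk_sum p b k i l * hess_entry p b l j = 0" for l
  proof (cases "l + k * p < i")
    case False
    then have "j + p < l" using Suc.prems by simp
    then show ?thesis by (simp add: hess_entry_def)
  qed (simp add: Suc.IH)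
  then show ?case by (auto intro: sum.neutral)
qed simp

text \<open>
  For \<open>i + k < n\<close> no walk of length \<open>k\<close> from \<open>i\<close> leaves the corner of size \<open>n\<close>.
\<close>

lemma pow_banded_hessenberg_entry:
  "i + k < n \<Longrightarrow> j < n \<Longrightarrow> (banded_hessenberg p b n ^\<^sub>m k) $$ (i, j) = walk_sum p b k i j"
proof (induction k arbitrary: j)
  case 0
  then show ?case by (auto simp: banded_hessenberg_def)
next
  case (Suc k)
  let ?H = "banded_hessenberg p b n"
  have c: "?H \<in> carrier_mat n n" "?H ^\<^sub>m k \<in> carrier_mat n n"
    by (intro banded_hessenberg_carrier pow_carrier_mat)+
  have "(?H ^\<^sub>m Suc k) $$ (i, j) = (\<Sum>l<n. (?H ^\<^sub>m k) $$ (i, l) * ?H $$ (l, j))"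
    using c Suc.prems by (simp add: scalar_prod_def atLeast0LessThan)
  also have "\<dots> = (\<Sum>l<n. walk_sum p b k i l * hess_entry p b l j)"
    using Suc by (intro sum.cong) (auto simp: banded_hessenberg_entry)
  also have "\<dots> = (\<Sum>l\<le>i + k. walk_sum p b k i l * hess_entry p b l j)"
    using Suc.prems by (intro sum.mono_neutral_right) (auto simp: walk_sum_above)
  finally show ?case by simp
qed

lemma hess_entry_shift: "hess_entry p b (i + s) (j + s) = hess_entry p (\<lambda>r m. b r (m + s)) i j"
  by (auto simp: hess_entry_def)

text \<open>
  The condition on \<open>i\<close> keeps the walks away from the upper end of the diagonal: a walk of length \<open>k\<close>
  from \<open>i + s\<close> cannot go below \<open>s\<close>.
\<close>

lemma walk_sum_shift:
  "k * p \<le> i \<Longrightarrow> walk_sum p b k (i + s) (j + s) = walk_sum p (\<lambda>r m. b r (m + s)) k i j"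
proof (induction k arbitrary: j)
  case (Suc k)
  have "walk_sum p b (Suc k) (i + s) (j + s) =
      (\<Sum>l\<in>{0 + s..i + k + s}. walk_sum p b k (i + s) l * hess_entry p b l (j + s))"
    using Suc.prems unfolding walk_sum.simps
    by (intro sum.mono_neutral_right) (auto simp: walk_sum_below)
  also have "\<dots> = (\<Sum>l\<le>i + k. walk_sum p b k (i + s) (l + s) * hess_entry p b (l + s) (j + s))"
    unfolding sum.shift_bounds_cl_nat_ivl by (simp add: atLeast0AtMost)
  also have "\<dots> = walk_sum p (\<lambda>r m. b r (m + s)) (Suc k) i j"
    using Suc by (simp add: hess_entry_shift)
  finally show ?case .
qed simp

lemma walk_sum_cong:
  assumes "\<And>r m. r \<le> p \<Longrightarrow> 1 \<le> m \<Longrightarrow> b r m = b' r m"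
  shows "walk_sum p b k i j = walk_sum p b' k i j"
proof -
  have "hess_entry p b = hess_entry p b'"
    using assms by (intro ext) (auto simp: hess_entry_def)
  then show ?thesis
    by (induction k arbitrary: j) auto
qed

lemma hess_entry_measurable:
  assumes "\<And>r m. r \<le> p \<Longrightarrow> 1 \<le> m \<Longrightarrow> (\<lambda>\<omega>. X r m \<omega>) \<in> borel_measurable M"
  shows "(\<lambda>\<omega>. hess_entry p (\<lambda>r m. X r m \<omega>) i j) \<in> borel_measurable M"
  unfolding hess_entry_def using assms
  by (cases "j = i + 1"; cases "j \<le> i \<and> i \<le> j + p") auto

lemma walk_sum_measurable:
  assumes "\<And>r m. r \<le> p \<Longrightarrow> 1 \<le> m \<Longrightarrow> (\<lambda>\<omega>. X r m \<omega>) \<in> borel_measurable M"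
  shows "(\<lambda>\<omega>. walk_sum p (\<lambda>r m. X r m \<omega>) k i j) \<in> borel_measurable M"
proof (induction k arbitrary: j)
  case (Suc k)
  then show ?case
    unfolding walk_sum.simps using hess_entry_measurable[OF assms]
    by (intro borel_measurable_sum borel_measurable_times) auto
qed simp

lemma pow_mat_entry_measurable:
  fixes A :: "'w \<Rightarrow> complex mat"
  assumes carr: "\<And>\<omega>. A \<omega> \<in> carrier_mat n n"
    and meas: "\<And>i j. i < n \<Longrightarrow> j < n \<Longrightarrow> (\<lambda>\<omega>. A \<omega> $$ (i, j)) \<in> borel_measurable M"
    and "i < n" "j < n"
  shows "(\<lambda>\<omega>. (A \<omega> ^\<^sub>m k) $$ (i, j)) \<in> borel_measurable M"
  using \<open>j < n\<close>
proof (induction k arbitrary: j)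
  case 0
  have "(A \<omega> ^\<^sub>m 0) $$ (i, j) = (if i = j then 1 else 0)" for \<omega>
    using carr[of \<omega>] 0 \<open>i < n\<close> by auto
  then show ?case by simp
next
  case (Suc k)
  have "(A \<omega> ^\<^sub>m Suc k) $$ (i, j) = (\<Sum>l<n. (A \<omega> ^\<^sub>m k) $$ (i, l) * A \<omega> $$ (l, j))" for \<omega>
    using carr[of \<omega>] pow_carrier_mat[OF carr, of \<omega> k] Suc.prems \<open>i < n\<close>
    by (simp add: scalar_prod_def atLeast0LessThan)
  then show ?case
    using Suc meas by (simp only:) (intro borel_measurable_sum borel_measurable_times; auto)
qed

lemma banded_hessenberg_row_sum_le:
  assumes "\<And>r m. r \<le> p \<Longrightarrow> 1 \<le> m \<Longrightarrow> cmod (b r m) \<le> C" and "i < n"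
  shows "(\<Sum>j<n. cmod (banded_hessenberg p b n $$ (i, j))) \<le> 1 + real (p + 1) * C"
proof -
  have C: "0 \<le> C"
    using assms(1)[of 0 1] norm_ge_zero[of "b 0 1"] by linarith
  have entry: "cmod (hess_entry p b i j) \<le> (if j = i + 1 then 1 else 0) + (\<Sum>r\<le>p. if i = j + r then C else 0)" for j
  proof (cases "j \<le> i \<and> i \<le> j + p")
    case True
    then have "(\<Sum>r\<le>p. if i = j + r then C else 0) = (\<Sum>r\<in>{i - j}. C)"
      by (intro sum.mono_neutral_cong_right) auto
    then show ?thesis
      using assms(1) True by (auto simp: hess_entry_def)
  next
    case False
    have "0 \<le> (\<Sum>r\<le>p. if i = j + r then C else 0)"
      using C by (intro sum_nonneg) auto
    then show ?thesis using False by (auto simp: hess_entry_def)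
  qed
  have "(\<Sum>j<n. cmod (banded_hessenberg p b n $$ (i, j))) = (\<Sum>j<n. cmod (hess_entry p b i j))"
    using \<open>i < n\<close> by (simp add: banded_hessenberg_entry)
  also have "\<dots> \<le> (\<Sum>j<n. (if j = i + 1 then 1 else 0) + (\<Sum>r\<le>p. if i = j + r then C else 0))"
    by (intro sum_mono entry)
  also have "\<dots> = (\<Sum>j<n. if j = i + 1 then 1 else 0) + (\<Sum>r\<le>p. \<Sum>j<n. if i = j + r then C else 0)"
    by (simp add: sum.distrib sum.swap[of _ "{..<n}"])
  also have "\<dots> \<le> 1 + (\<Sum>r\<le>p. C)"
  proof (intro add_mono sum_mono)
    fix r
    have "(\<Sum>j<n. if i = j + r then C else 0) \<le> (\<Sum>j\<in>{i - r}. C)"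
    proof -
      have "(\<Sum>j<n. if i = j + r then C else 0) = (\<Sum>j\<in>{j. j < n \<and> i = j + r}. C)"
        by (subst sum.inter_filter[symmetric]) auto
      also have "\<dots> \<le> (\<Sum>j\<in>{i - r}. C)"
        using C by (intro sum_mono2) auto
      finally show ?thesis .
    qed
    then show "(\<Sum>j<n. if i = j + r then C else 0) \<le> C" by simp
  qed simp
  finally show ?thesis by simp
qed

text \<open>
  The law of the whole family is a product measure whose factors do not change along the second
  index, so it is invariant under shifting this index.
\<close>

lemma (in prob_space) expectation_iid_shift:
  fixes G :: "(nat \<times> nat \<Rightarrow> complex) \<Rightarrow> complex"
  assumes "indep_vars (\<lambda>_. borel) (\<lambda>(k, n). a k n) ({..p} \<times> {1..})"
    and rv: "\<And>k n. k \<le> p \<Longrightarrow> 1 \<le> n \<Longrightarrow> a k n \<in> borel_measurable M \<and> distr M borel (a k n) = \<mu> k"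
    and G: "G \<in> borel_measurable (Pi\<^sub>M ({..p} \<times> {1..}) (\<lambda>_. borel))"
  shows "expectation (\<lambda>\<omega>. G (\<lambda>i\<in>{..p} \<times> {1..}. a (fst i) (snd i + s) \<omega>)) =
    expectation (\<lambda>\<omega>. G (\<lambda>i\<in>{..p} \<times> {1..}. a (fst i) (snd i) \<omega>))"
proof -
  let ?I = "{..p} \<times> {1::nat..}"
  let ?B = "Pi\<^sub>M ?I (\<lambda>_. borel :: complex measure)"
  let ?P = "Pi\<^sub>M ?I (\<lambda>i. \<mu> (fst i))"
  let ?f = "\<lambda>i :: nat \<times> nat. (fst i, snd i + s)"
  let ?X = "\<lambda>\<omega>. \<lambda>i\<in>?I. a (fst i) (snd i) \<omega>"
  let ?T = "\<lambda>x :: nat \<times> nat \<Rightarrow> complex. \<lambda>i\<in>?I. x (?f i)"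
  have \<mu>: "prob_space (\<mu> k) \<and> sets (\<mu> k) = sets borel" if "k \<le> p" for k
    using rv[OF that, of 1] by (metis prob_space_distr order_refl sets_distr)
  have X[measurable]: "?X \<in> measurable M ?B"
    using rv by (intro measurable_restrict) auto
  have T[measurable]: "?T \<in> measurable ?B ?B"
    by (intro measurable_restrict measurable_component_singleton) auto
  have "distr M ?B ?X = Pi\<^sub>M ?I (\<lambda>i. distr M borel (a (fst i) (snd i)))"
    using indep_vars_iff_distr_eq_PiM'[of ?I "\<lambda>(k, n). a k n" "\<lambda>_. borel"] assms(1) rv
    by (auto simp: case_prod_beta)
  also have "\<dots> = ?P"
    using rv by (intro PiM_cong) auto
  finally have law: "distr M ?B ?X = ?P" .
  have "distr ?P (Pi\<^sub>M ?I (\<lambda>i. \<mu> (fst (?f i)))) ?T = Pi\<^sub>M ?I (\<lambda>i. \<mu> (fst (?f i)))"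
    using \<mu> by (intro distr_PiM_reindex) (auto simp: inj_on_def)
  then have "distr ?P ?P ?T = ?P" by simp
  moreover have "distr ?P ?P ?T = distr ?P ?B ?T"
    using \<mu> by (intro distr_cong refl sets_PiM_cong) auto
  ultimately have shift: "distr (distr M ?B ?X) ?B ?T = distr M ?B ?X"
    unfolding law by simp
  have TX: "?T (?X \<omega>) = (\<lambda>i\<in>?I. a (fst i) (snd i + s) \<omega>)" for \<omega>
    by (intro ext) (auto simp: restrict_def)
  have "expectation (\<lambda>\<omega>. G (?X \<omega>)) = integral\<^sup>L (distr (distr M ?B ?X) ?B ?T) G"
    unfolding shift by (rule integral_distr[OF X G, symmetric])
  also have "\<dots> = integral\<^sup>L (distr M ?B ?X) (\<lambda>x. G (?T x))"
    by (rule integral_distr[OF _ G]) (simp only: measurable_distr_eq1 T)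
  also have "\<dots> = expectation (\<lambda>\<omega>. G (?T (?X \<omega>)))"
    by (rule integral_distr[OF X measurable_compose[OF T G]])
  finally show ?thesis by (simp only: TX)
qed

lemma (in prob_space) expectation_walk_sum_shift:
  assumes indep: "indep_vars (\<lambda>_. borel) (\<lambda>(k, n). a k n) ({..p} \<times> {1..})"
    and rv: "\<And>k n. k \<le> p \<Longrightarrow> 1 \<le> n \<Longrightarrow> a k n \<in> borel_measurable M \<and> distr M borel (a k n) = \<mu> k"
    and "k * p \<le> i"
  shows "expectation (\<lambda>\<omega>. walk_sum p (\<lambda>r m. a r m \<omega>) k i i) =
    expectation (\<lambda>\<omega>. walk_sum p (\<lambda>r m. a r m \<omega>) k (k * p) (k * p))"
proof -
  let ?I = "{..p} \<times> {1::nat..}"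
  define s where "s = i - k * p"
  have i: "i = k * p + s" using \<open>k * p \<le> i\<close> by (simp add: s_def)
  define G where "G = (\<lambda>x :: nat \<times> nat \<Rightarrow> complex. walk_sum p (\<lambda>r m. x (r, m)) k (k * p) (k * p))"
  have "G \<in> borel_measurable (Pi\<^sub>M ?I (\<lambda>_. borel))"
    unfolding G_def by (intro walk_sum_measurable measurable_component_singleton) auto
  note shift = expectation_iid_shift[OF indep rv this, of s]
  have "walk_sum p (\<lambda>r m. a r m \<omega>) k i i = G (\<lambda>i\<in>?I. a (fst i) (snd i + s) \<omega>)" for \<omega>
    unfolding i walk_sum_shift[OF order_refl] G_def by (intro walk_sum_cong) auto
  moreover have "walk_sum p (\<lambda>r m. a r m \<omega>) k (k * p) (k * p) = G (\<lambda>i\<in>?I. a (fst i) (snd i) \<omega>)" for \<omega>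
    unfolding G_def by (intro walk_sum_cong) auto
  ultimately show ?thesis
    using shift by simp
qed

text \<open>
  At most \<open>K + k\<close> of the first \<open>n\<close> terms differ from \<open>c\<close>.
\<close>

lemma average_tendsto_of_interior_const:
  fixes u :: "nat \<Rightarrow> nat \<Rightarrow> 'a::real_normed_vector"
  assumes const: "\<And>n i. K \<le> i \<Longrightarrow> i + k < n \<Longrightarrow> u n i = c"
    and bound: "\<And>n i. i < n \<Longrightarrow> norm (u n i) \<le> D"
  shows "(\<lambda>n. (\<Sum>i<n. u n i) /\<^sub>R real n) \<longlonglongrightarrow> c"
proof (rule LIM_zero_cancel, rule Lim_null_comparison)
  have D: "0 \<le> D" using bound[of 0 1] norm_ge_zero[of "u 1 0"] by linarith
  show "(\<lambda>n. real (K + k) * (D + norm c) / real n) \<longlonglongrightarrow> 0"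
    by (rule lim_const_over_n)
  have "norm ((\<Sum>i<n. u n i) /\<^sub>R real n - c) \<le> real (K + k) * (D + norm c) / real n" if "0 < n" for n
  proof -
    have interior: "u n i = c" if "i < n" "i \<notin> {..<K} \<union> {n - k..<n}" for i
      using that const[of i n] by (simp add: not_less not_le less_diff_conv)
    have "(\<Sum>i<n. u n i) - real n *\<^sub>R c = (\<Sum>i<n. u n i - c)"
      by (simp add: sum_subtractf scaleR_conv_of_real sum_constant_scaleR)
    also have "\<dots> = (\<Sum>i\<in>{..<n} \<inter> ({..<K} \<union> {n - k..<n}). u n i - c)"
      using interior by (intro sum.mono_neutral_right) auto
    also have "norm \<dots> \<le> (\<Sum>i\<in>{..<n} \<inter> ({..<K} \<union> {n - k..<n}). D + norm c)"
      using bound by (intro sum_norm_le order_trans[OF norm_triangle_ineq4] add_mono) auto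
    also have "\<dots> = real (card ({..<n} \<inter> ({..<K} \<union> {n - k..<n}))) * (D + norm c)"
      by simp
    also have "\<dots> \<le> real (K + k) * (D + norm c)"
    proof (intro mult_right_mono)
      have "card ({..<n} \<inter> ({..<K} \<union> {n - k..<n})) \<le> card ({..<K} \<union> {n - k..<n})"
        by (intro card_mono) auto
      also have "\<dots> \<le> K + k"
        by (rule order_trans[OF card_Un_le]) simp
      finally show "real (card ({..<n} \<inter> ({..<K} \<union> {n - k..<n}))) \<le> real (K + k)"
        by simp
    qed (use D in simp)
    finally have "norm ((\<Sum>i<n. u n i) - real n *\<^sub>R c) / real n \<le> real (K + k) * (D + norm c) / real n"
      by (rule divide_right_mono) simp
    moreover have "(\<Sum>i<n. u n i) /\<^sub>R real n - c = ((\<Sum>i<n. u n i) - real n *\<^sub>R c) /\<^sub>R real n"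
      using that by (simp add: scaleR_diff_right)
    ultimately show ?thesis
      by (simp add: divide_inverse mult.commute)
  qed
  then show "\<forall>\<^sub>F n in sequentially. norm ((\<Sum>i<n. u n i) /\<^sub>R real n - c) \<le> real (K + k) * (D + norm c) / real n"
    by (rule eventually_mono[OF eventually_gt_at_top[of 0]])
qed

text \<open>
  The bound comes from the row sums, and hence does not depend on \<open>n\<close>.
\<close>

lemma (in prob_space) pow_banded_hessenberg_diag:
  assumes meas: "\<And>k n. k \<le> p \<Longrightarrow> 1 \<le> n \<Longrightarrow> a k n \<in> borel_measurable M"
    and bound: "\<And>k n \<omega>. k \<le> p \<Longrightarrow> 1 \<le> n \<Longrightarrow> \<omega> \<in> space M \<Longrightarrow> cmod (a k n \<omega>) \<le> C"
    and "i < n"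
  defines "H \<equiv> \<lambda>n \<omega>. banded_hessenberg p (\<lambda>k j. a k j \<omega>) n"
  shows integrable_pow_banded_hessenberg_diag: "integrable M (\<lambda>\<omega>. (H n \<omega> ^\<^sub>m k) $$ (i, i))"
    and norm_expectation_pow_banded_hessenberg_diag_le:
      "norm (expectation (\<lambda>\<omega>. (H n \<omega> ^\<^sub>m k) $$ (i, i))) \<le> (1 + real (p + 1) * C) ^ k"
proof -
  define B where "B = 1 + real (p + 1) * C"
  have carr: "H n \<omega> \<in> carrier_mat n n" for \<omega>
    unfolding H_def by (rule banded_hessenberg_carrier)
  have entry: "(\<lambda>\<omega>. H n \<omega> $$ (i, j)) \<in> borel_measurable M" if "i < n" "j < n" for i j
    unfolding H_def banded_hessenberg_entry[OF that] using meas by (intro hess_entry_measurable) auto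
  have pow: "(\<lambda>\<omega>. (H n \<omega> ^\<^sub>m k) $$ (i, i)) \<in> borel_measurable M"
    by (rule pow_mat_entry_measurable[OF carr entry \<open>i < n\<close> \<open>i < n\<close>])
  have le: "cmod ((H n \<omega> ^\<^sub>m k) $$ (i, i)) \<le> B ^ k" if "\<omega> \<in> space M" for \<omega>
  proof -
    have "cmod ((H n \<omega> ^\<^sub>m k) $$ (i, i)) \<le> (\<Sum>j<n. cmod ((H n \<omega> ^\<^sub>m k) $$ (i, j)))"
      using \<open>i < n\<close> by (intro member_le_sum) auto
    also have "\<dots> \<le> B ^ k"
      unfolding B_def H_def using that \<open>i < n\<close> bound
      by (intro pow_mat_row_sum_le banded_hessenberg_row_sum_le banded_hessenberg_carrier) auto
    finally show ?thesis .
  qed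
  show int: "integrable M (\<lambda>\<omega>. (H n \<omega> ^\<^sub>m k) $$ (i, i))"
    using le pow by (intro integrable_const_bound[where B = "B ^ k"]) auto
  have "norm (expectation (\<lambda>\<omega>. (H n \<omega> ^\<^sub>m k) $$ (i, i))) \<le> expectation (\<lambda>\<omega>. cmod ((H n \<omega> ^\<^sub>m k) $$ (i, i)))"
    by (rule integral_norm_bound)
  also have "\<dots> \<le> expectation (\<lambda>_. B ^ k)"
    using le int by (intro integral_mono) auto
  finally show "norm (expectation (\<lambda>\<omega>. (H n \<omega> ^\<^sub>m k) $$ (i, i))) \<le> (1 + real (p + 1) * C) ^ k"
    by (simp add: prob_space B_def)
qed

lemma (in prob_space) expectation_trace_tendsto:
  assumes indep: "indep_vars (\<lambda>_. borel) (\<lambda>(k, n). a k n) ({..p} \<times> {1..})"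
    and rv: "\<And>k n. k \<le> p \<Longrightarrow> 1 \<le> n \<Longrightarrow> a k n \<in> borel_measurable M \<and> distr M borel (a k n) = \<mu> k"
    and bound: "\<And>k n \<omega>. k \<le> p \<Longrightarrow> 1 \<le> n \<Longrightarrow> \<omega> \<in> space M \<Longrightarrow> cmod (a k n \<omega>) \<le> C"
  defines "H \<equiv> \<lambda>n \<omega>. banded_hessenberg p (\<lambda>k j. a k j \<omega>) n"
  shows "(\<lambda>n. (\<Sum>i<n. expectation (\<lambda>\<omega>. (H n \<omega> ^\<^sub>m k) $$ (i, i))) /\<^sub>R real n)
    \<longlonglongrightarrow> expectation (\<lambda>\<omega>. walk_sum p (\<lambda>r m. a r m \<omega>) k (k * p) (k * p))"
proof (rule average_tendsto_of_interior_const)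
  fix n i assume i: "k * p \<le> i" "i + k < n"
  then have "(H n \<omega> ^\<^sub>m k) $$ (i, i) = walk_sum p (\<lambda>r m. a r m \<omega>) k i i" for \<omega>
    unfolding H_def by (intro pow_banded_hessenberg_entry) auto
  then show "expectation (\<lambda>\<omega>. (H n \<omega> ^\<^sub>m k) $$ (i, i)) =
      expectation (\<lambda>\<omega>. walk_sum p (\<lambda>r m. a r m \<omega>) k (k * p) (k * p))"
    using expectation_walk_sum_shift[OF indep rv i(1)] by simp
next
  fix n i :: nat assume "i < n"
  then show "norm (expectation (\<lambda>\<omega>. (H n \<omega> ^\<^sub>m k) $$ (i, i))) \<le> (1 + real (p + 1) * C) ^ k"
    unfolding H_def using rv bound
    by (intro norm_expectation_pow_banded_hessenberg_diag_le) auto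
qed

section \<open>From moments to weak convergence\<close>

lemma convergent_of_approx:
  fixes u :: "nat \<Rightarrow> real"
  assumes "\<And>e. 0 < e \<Longrightarrow> \<exists>v. convergent v \<and> (\<forall>n. \<bar>u n - v n\<bar> \<le> e)"
  shows "convergent u"
proof (rule Cauchy_convergent, rule metric_CauchyI)
  fix e :: real assume "0 < e"
  then obtain v where v: "convergent v" "\<And>n. \<bar>u n - v n\<bar> \<le> e / 4"
    using assms[of "e / 4"] by auto
  then obtain N where N: "\<And>m n. N \<le> m \<Longrightarrow> N \<le> n \<Longrightarrow> dist (v m) (v n) < e / 4"
    using \<open>0 < e\<close> metric_CauchyD[OF convergent_Cauchy[OF v(1)], of "e / 4"] by auto
  have "dist (u m) (u n) < e" if "N \<le> m" "N \<le> n" for m n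
    using N[OF that] v(2)[of m] v(2)[of n] \<open>0 < e\<close> unfolding dist_real_def by linarith
  then show "\<exists>N. \<forall>m\<ge>N. \<forall>n\<ge>N. dist (u m) (u n) < e" by blast
qed

text \<open>
  Weierstrass approximation on \<open>{-R..R}\<close>, which carries all the measures: the error is
  uniform in \<open>n\<close>, and the integrals of a polynomial converge by assumption.
\<close>

lemma convergent_integral_of_convergent_moments:
  fixes \<nu> :: "nat \<Rightarrow> real measure" and f :: "real \<Rightarrow> real"
  assumes distr: "\<And>n. real_distribution (\<nu> n)"
    and supp: "\<And>n. AE x in \<nu> n. \<bar>x\<bar> \<le> R"
    and moments: "\<And>k. convergent (\<lambda>n. \<integral>x. x ^ k \<partial>\<nu> n)"
    and f: "continuous_on UNIV f" "bounded (range f)"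
  shows "convergent (\<lambda>n. \<integral>x. f x \<partial>\<nu> n)"
proof (rule convergent_of_approx)
  interpret \<nu>: real_distribution "\<nu> n" for n by (rule distr)
  fix e :: real assume "0 < e"
  moreover have "continuous_on {-R..R} f"
    using f(1) by (rule continuous_on_subset) auto
  ultimately obtain g where g: "real_polynomial_function g" and fg: "\<And>x. x \<in> {-R..R} \<Longrightarrow> \<bar>f x - g x\<bar> < e"
    using Stone_Weierstrass_real_polynomial_function[of "{-R..R}" f e] by auto
  then obtain a d where gs: "g = (\<lambda>x. \<Sum>i\<le>d. a i * x ^ i)"
    using real_polynomial_function_imp_sum by blast
  have pow: "integrable (\<nu> n) (\<lambda>x. x ^ i)" for n i
    using supp[of n]
    by (intro \<nu>.integrable_const_bound[where B = "R ^ i"]) (auto simp: power_abs intro: power_mono elim!: eventually_mono)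
  then have int_g: "integrable (\<nu> n) g" for n
    unfolding gs by auto
  obtain B where "\<And>x. \<bar>f x\<bar> \<le> B"
    using f(2) by (auto simp: bounded_iff)
  moreover have [measurable]: "f \<in> borel_measurable borel"
    using f(1) by (rule borel_measurable_continuous_onI)
  ultimately have int_f: "integrable (\<nu> n) f" for n
    by (intro \<nu>.integrable_const_bound[where B = B]) auto
  have "\<bar>(\<integral>x. f x \<partial>\<nu> n) - (\<integral>x. g x \<partial>\<nu> n)\<bar> \<le> e" for n
  proof -
    have "\<bar>(\<integral>x. f x \<partial>\<nu> n) - (\<integral>x. g x \<partial>\<nu> n)\<bar> = \<bar>\<integral>x. f x - g x \<partial>\<nu> n\<bar>"
      using int_f int_g by simp
    also have "\<dots> \<le> (\<integral>x. \<bar>f x - g x\<bar> \<partial>\<nu> n)"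
      by (rule integral_abs_bound)
    also have "\<dots> \<le> (\<integral>x. e \<partial>\<nu> n)"
    proof (intro integral_mono_AE)
      show "AE x in \<nu> n. \<bar>f x - g x\<bar> \<le> e"
        using supp[of n]
      proof eventually_elim
        case (elim x)
        then have "x \<in> {-R..R}" by auto
        from fg[OF this] show ?case by simp
      qed
    qed (use int_f int_g in auto)
    finally show ?thesis using \<nu>.prob_space[of n] by simp
  qed
  moreover have "convergent (\<lambda>n. \<integral>x. g x \<partial>\<nu> n)"
    unfolding gs using pow moments
    by (simp add: Bochner_Integration.integral_sum convergent_sum convergent_mult convergent_const)
  ultimately show "\<exists>v. convergent v \<and> (\<forall>n. \<bar>(\<integral>x. f x \<partial>\<nu> n) - v n\<bar> \<le> e)"
    by blast
qed

text \<open>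
  Since all integrals of bounded continuous functions converge, it is enough to identify the limit
  along one subsequence; Helly's theorem provides a subsequence with a weak limit.
\<close>

lemma weak_limit_of_convergent_moments:
  fixes \<nu> :: "nat \<Rightarrow> real measure"
  assumes distr: "\<And>n. real_distribution (\<nu> n)"
    and supp: "\<And>n. AE x in \<nu> n. \<bar>x\<bar> \<le> R"
    and moments: "\<And>k. convergent (\<lambda>n. \<integral>x. x ^ k \<partial>\<nu> n)"
  obtains \<nu>' where "real_distribution \<nu>'"
    and "\<And>f :: real \<Rightarrow> real. continuous_on UNIV f \<Longrightarrow> bounded (range f) \<Longrightarrow>
      (\<lambda>n. \<integral>x. f x \<partial>\<nu> n) \<longlonglongrightarrow> (\<integral>x. f x \<partial>\<nu>')"
proof -
  interpret \<nu>: real_distribution "\<nu> n" for n by (rule distr)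
  have "measure (\<nu> n) {-\<bar>R\<bar> - 1<..\<bar>R\<bar> + 1} = 1" for n
    using supp[of n] by (intro \<nu>.prob_eq_1[THEN iffD2]) (auto elim!: eventually_mono)
  then have "tight \<nu>"
    unfolding tight_def using distr
    by (intro conjI allI impI exI[where x = "- \<bar>R\<bar> - 1"] exI[where x = "\<bar>R\<bar> + 1"]) auto
  then obtain r \<nu>' where r: "strict_mono r" "real_distribution \<nu>'" "weak_conv_m (\<nu> \<circ> id \<circ> r) \<nu>'"
    using tight_imp_convergent_subsubsequence[of \<nu> id] by (auto simp: strict_mono_def)
  have "(\<lambda>n. \<integral>x. f x \<partial>\<nu> n) \<longlonglongrightarrow> (\<integral>x. f x \<partial>\<nu>')"
    if f: "continuous_on UNIV f" "bounded (range f)" for f :: "real \<Rightarrow> real"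
  proof -
    obtain B where B: "\<And>x. norm (f x) \<le> B"
      using f(2) by (auto simp: bounded_iff)
    have "isCont f x" for x
      using f(1) by (simp add: continuous_on_eq_continuous_at)
    then have sub: "(\<lambda>n. \<integral>x. f x \<partial>\<nu> (r n)) \<longlonglongrightarrow> (\<integral>x. f x \<partial>\<nu>')"
      using weak_conv_imp_integral_bdd_continuous_conv[of "\<nu> \<circ> id \<circ> r" \<nu>' f B] r distr B by simp
    obtain L where L: "(\<lambda>n. \<integral>x. f x \<partial>\<nu> n) \<longlonglongrightarrow> L"
      using convergent_integral_of_convergent_moments[OF distr supp moments f] by (auto simp: convergent_def)
    have "L = (\<integral>x. f x \<partial>\<nu>')"
      using LIMSEQ_subseq_LIMSEQ[OF L r(1)] sub by (auto simp: o_def intro: LIMSEQ_unique)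
    then show ?thesis using L by simp
  qed
  with r(2) show ?thesis by (rule that)
qed

section \<open>The limit of the mean spectral measures\<close>

theorem mainTheorem2:
  fixes M :: "'w measure"
    and p :: nat
    and \<mu> :: "nat \<Rightarrow> complex measure"
    and a :: "nat \<Rightarrow> nat \<Rightarrow> 'w \<Rightarrow> complex"
    and H :: "nat \<Rightarrow> 'w \<Rightarrow> complex mat"
  defines "H \<equiv> \<lambda>n \<omega>. banded_hessenberg p (\<lambda>k j. a k j \<omega>) n"
  assumes "prob_space M"
    and "1 \<le> p"
    and "\<And>k. k \<le> p \<Longrightarrow> prob_space (\<mu> k) \<and> sets (\<mu> k) = sets borel \<and> compact (measure_support (\<mu> k))"
    and "\<And>k n. k \<le> p \<Longrightarrow> 1 \<le> n \<Longrightarrow> a k n \<in> borel_measurable M \<and> distr M borel (a k n) = \<mu> k"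
    and "prob_space.indep_vars M (\<lambda>_. borel) (\<lambda>(k, n). a k n) ({..p} \<times> {1..})"
    and "\<exists>C. \<forall>k\<le>p. \<forall>n\<ge>1. \<forall>\<omega>\<in>space M. cmod (a k n \<omega>) \<le> C"
    and "\<And>n. 1 \<le> n \<Longrightarrow> AE \<omega> in M. \<forall>z. eigenvalue (H n \<omega>) z \<longrightarrow> z \<in> \<real>"
  shows "\<exists>\<nu>. real_distribution \<nu> \<and>
    weakly_converges (\<lambda>n. mean_measure M (\<lambda>\<omega>. empirical_spectral_measure (H n \<omega>)))
      (distr \<nu> borel complex_of_real)"
proof -
  interpret prob_space M by fact
  note indep = \<open>indep_vars (\<lambda>_. borel) (\<lambda>(k, n). a k n) ({..p} \<times> {1..})\<close>
  note rv = \<open>\<And>k n. k \<le> p \<Longrightarrow> 1 \<le> n \<Longrightarrow> a k n \<in> borel_measurable M \<and> distr M borel (a k n) = \<mu> k\<close>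
  note real_ev = \<open>\<And>n. 1 \<le> n \<Longrightarrow> AE \<omega> in M. \<forall>z. eigenvalue (H n \<omega>) z \<longrightarrow> z \<in> \<real>\<close>
  obtain C where C: "\<And>k n \<omega>. k \<le> p \<Longrightarrow> 1 \<le> n \<Longrightarrow> \<omega> \<in> space M \<Longrightarrow> cmod (a k n \<omega>) \<le> C"
    using \<open>\<exists>C. \<forall>k\<le>p. \<forall>n\<ge>1. \<forall>\<omega>\<in>space M. cmod (a k n \<omega>) \<le> C\<close> by blast
  define R where "R = \<bar>1 + real (p + 1) * C\<bar>"
  have carr: "H n \<omega> \<in> carrier_mat n n" for n \<omega>
    unfolding H_def by (rule banded_hessenberg_carrier)
  have entry: "(\<lambda>\<omega>. H n \<omega> $$ (i, j)) \<in> borel_measurable M" if "i < n" "j < n" for n i j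
    unfolding H_def banded_hessenberg_entry[OF that] using rv by (intro hess_entry_measurable) auto
  have ev_bound: "cmod z \<le> R" if "\<omega> \<in> space M" "eigenvalue (H n \<omega>) z" for n \<omega> z
  proof -
    have "cmod z \<le> 1 + real (p + 1) * C"
    proof (rule eigenvalue_cmod_le_row_sum[OF carr that(2)])
      show "(\<Sum>j<n. cmod (H n \<omega> $$ (i, j))) \<le> 1 + real (p + 1) * C" if "i < n" for i
        unfolding H_def using C \<open>\<omega> \<in> space M\<close> that by (intro banded_hessenberg_row_sum_le)
    qed
    then show ?thesis by (simp add: R_def)
  qed
  have R: "0 \<le> R" by (simp add: R_def)
  define \<sigma> where "\<sigma> = (\<lambda>n \<omega>. empirical_spectral_measure (H n \<omega>))"
  define \<nu> where "\<nu> = (\<lambda>n. mean_measure M (\<sigma> n))"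
  have mean: "is_mean_measure M (\<sigma> n) (\<nu> n)"
    and AE_\<nu>: "\<And>S. closed S \<Longrightarrow> AE \<omega> in M. \<forall>z. eigenvalue (H n \<omega>) z \<longrightarrow> z \<in> S \<Longrightarrow> AE z in \<nu> n. z \<in> S"
    if "0 < n" for n
  proof -
    note bind = bind_empirical[where A = "H n", OF prob_space_axioms that carr _ _ R]
    have mean: "is_mean_measure M (\<sigma> n) (M \<bind> \<sigma> n)"
      unfolding \<sigma>_def by (rule bind(1)) (use entry ev_bound in blast)+
    then have eq: "\<nu> n = M \<bind> \<sigma> n"
      unfolding \<nu>_def by (rule mean_measure_eq)
    show "is_mean_measure M (\<sigma> n) (\<nu> n)"
      unfolding eq by (rule mean)
    show "AE z in \<nu> n. z \<in> S" if "closed S" "AE \<omega> in M. \<forall>z. eigenvalue (H n \<omega>) z \<longrightarrow> z \<in> S" for S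
      unfolding eq \<sigma>_def by (rule bind(2)) (use that entry ev_bound in blast)+
  qed
  have \<nu>_prob: "prob_space (\<nu> n)" and \<nu>_sets: "sets (\<nu> n) = sets borel" if "0 < n" for n
    using mean[OF that] by (auto simp: is_mean_measure_def)
  have \<nu>_meas: "f \<in> borel_measurable (\<nu> n)" if "0 < n" "continuous_on UNIV f"
    for n and f :: "complex \<Rightarrow> real"
    using borel_measurable_continuous_onI[OF that(2)] by (simp add: measurable_cong_sets[OF \<nu>_sets[OF that(1)] refl])
  have \<nu>_real: "AE z in \<nu> n. z \<in> \<real>" if "0 < n" for n
    using real_ev[of n] that by (intro AE_\<nu> closed_complex_Reals) auto
  \<comment> \<open>Helly's theorem concerns distributions on the real line. The index is shifted because the
    empty matrix has no spectral measure of mass one.\<close>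
  define \<rho> where "\<rho> = (\<lambda>n. distr (\<nu> (Suc n)) borel Re)"
  have Re_meas: "Re \<in> borel_measurable (\<nu> (Suc n))" for n
    by (intro \<nu>_meas continuous_intros) simp
  have \<rho>: "real_distribution (\<rho> n)" for n
    unfolding \<rho>_def using prob_space.prob_space_distr[OF \<nu>_prob Re_meas]
    by (simp add: real_distribution_def real_distribution_axioms_def)
  have \<rho>_bound: "AE x in \<rho> n. \<bar>x\<bar> \<le> R" for n
  proof -
    have "AE z in \<nu> (Suc n). z \<in> cball 0 R"
      using ev_bound by (intro AE_\<nu>) auto
    then have "AE z in \<nu> (Suc n). \<bar>Re z\<bar> \<le> R"
      by (rule eventually_mono) (simp, metis abs_Re_le_cmod order_trans)
    then show ?thesis
      unfolding \<rho>_def by (subst AE_distr_iff[OF Re_meas]) auto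
  qed
  have \<rho>_integral: "(\<integral>x. f (complex_of_real x) \<partial>\<rho> n) = (\<integral>z. f z \<partial>\<nu> (Suc n))"
    if f: "continuous_on UNIV f" for f :: "complex \<Rightarrow> real" and n
  proof -
    have c: "continuous_on UNIV (\<lambda>x. f (complex_of_real x))"
      by (intro continuous_on_compose2[OF f] continuous_intros) auto
    have "(\<integral>x. f (complex_of_real x) \<partial>\<rho> n) = (\<integral>z. f (complex_of_real (Re z)) \<partial>\<nu> (Suc n))"
      unfolding \<rho>_def by (rule integral_distr[OF Re_meas borel_measurable_continuous_onI[OF c]])
    also have "\<dots> = (\<integral>z. f z \<partial>\<nu> (Suc n))"
    proof (rule integral_cong_AE)
      show "(\<lambda>z. f (complex_of_real (Re z))) \<in> borel_measurable (\<nu> (Suc n))"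
        by (intro \<nu>_meas continuous_on_compose2[OF c] continuous_intros) auto
      show "AE z in \<nu> (Suc n). f (complex_of_real (Re z)) = f z"
        using \<nu>_real[of "Suc n"] by (auto elim!: eventually_mono)
    qed (intro \<nu>_meas f; simp)
    finally show ?thesis .
  qed
  have moments: "convergent (\<lambda>n. \<integral>x. x ^ k \<partial>\<rho> n)" for k
  proof -
    let ?E = "\<lambda>n. \<Sum>i<n. expectation (\<lambda>\<omega>. (H n \<omega> ^\<^sub>m k) $$ (i, i))"
    have "(\<integral>x. x ^ k \<partial>\<rho> n) = Re (?E (Suc n) /\<^sub>R real (Suc n))" for n
    proof -
      have int: "integrable M (\<lambda>\<omega>. (H (Suc n) \<omega> ^\<^sub>m k) $$ (i, i))" if "i < Suc n" for i
        unfolding H_def using rv C that by (intro integrable_pow_banded_hessenberg_diag) auto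
      have c: "continuous_on UNIV (\<lambda>z :: complex. Re (z ^ k))"
        by (intro continuous_intros)
      \<comment> \<open>On the real line \<open>z ^ k\<close> is real, so the real part of the complex moment is the real moment.\<close>
      have "(\<integral>x. x ^ k \<partial>\<rho> n) = (\<integral>z. Re (z ^ k) \<partial>\<nu> (Suc n))"
        using \<rho>_integral[OF c, of n] by (simp flip: of_real_power)
      also have "\<dots> = expectation (\<lambda>\<omega>. \<integral>z. Re (z ^ k) \<partial>\<sigma> (Suc n) \<omega>)"
        using mean[of "Suc n"] c by (simp add: is_mean_measure_def)
      also have "\<dots> = expectation (\<lambda>\<omega>. Re (\<Sum>i<Suc n. (H (Suc n) \<omega> ^\<^sub>m k) $$ (i, i)) / real (Suc n))"
      proof (rule Bochner_Integration.integral_cong[OF refl])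
        fix \<omega>
        have "(\<Sum>z\<in>#X. Re (z ^ k)) = Re (\<Sum>z\<in>#X. z ^ k)" for X
          by (induction X) auto
        then show "(\<integral>z. Re (z ^ k) \<partial>\<sigma> (Suc n) \<omega>) = Re (\<Sum>i<Suc n. (H (Suc n) \<omega> ^\<^sub>m k) $$ (i, i)) / real (Suc n)"
          unfolding \<sigma>_def sum_eigenvalues_power[OF carr, symmetric]
          by (subst integral_empirical_spectral_measure[OF carr])
            (auto intro: borel_measurable_continuous_onI c)
      qed
      also have "\<dots> = Re (expectation (\<lambda>\<omega>. \<Sum>i<Suc n. (H (Suc n) \<omega> ^\<^sub>m k) $$ (i, i))) / real (Suc n)"
        using int by (subst integral_divide_zero, subst integral_Re) (auto simp del: sum.lessThan_Suc)
      also have "\<dots> = Re (?E (Suc n) /\<^sub>R real (Suc n))"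
        using int by (subst Bochner_Integration.integral_sum) (auto simp: divide_inverse mult.commute simp del: sum.lessThan_Suc of_nat_Suc)
      finally show ?thesis .
    qed
    moreover have "(\<lambda>n. ?E n /\<^sub>R real n) \<longlonglongrightarrow> expectation (\<lambda>\<omega>. walk_sum p (\<lambda>r m. a r m \<omega>) k (k * p) (k * p))"
      unfolding H_def by (rule expectation_trace_tendsto[OF indep rv C])
    then have "(\<lambda>n. Re (?E (Suc n) /\<^sub>R real (Suc n))) \<longlonglongrightarrow>
        Re (expectation (\<lambda>\<omega>. walk_sum p (\<lambda>r m. a r m \<omega>) k (k * p) (k * p)))"
      by (intro tendsto_Re LIMSEQ_Suc)
    ultimately show ?thesis
      by (simp add: convergent_def) blast
  qed
  obtain \<nu>' where \<nu>': "real_distribution \<nu>'"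
    and lim: "\<And>f :: real \<Rightarrow> real. continuous_on UNIV f \<Longrightarrow> bounded (range f) \<Longrightarrow>
      (\<lambda>n. \<integral>x. f x \<partial>\<rho> n) \<longlonglongrightarrow> (\<integral>x. f x \<partial>\<nu>')"
    using weak_limit_of_convergent_moments[OF \<rho> \<rho>_bound moments] by blast
  interpret \<nu>': real_distribution \<nu>' by fact
  have "(\<lambda>n. \<integral>z. f z \<partial>\<nu> n) \<longlonglongrightarrow> (\<integral>z. f z \<partial>distr \<nu>' borel complex_of_real)"
    if f: "continuous_on UNIV f" "bounded (range f)" for f :: "complex \<Rightarrow> real"
  proof (rule LIMSEQ_imp_Suc)
    have c: "continuous_on UNIV (\<lambda>x. f (complex_of_real x))"
      by (intro continuous_on_compose2[OF f(1)] continuous_intros) auto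
    moreover have "bounded (range (\<lambda>x. f (complex_of_real x)))"
      using f(2) by (rule bounded_subset) auto
    ultimately have "(\<lambda>n. \<integral>z. f z \<partial>\<nu> (Suc n)) \<longlonglongrightarrow> (\<integral>x. f (complex_of_real x) \<partial>\<nu>')"
      unfolding \<rho>_integral[OF f(1), symmetric] by (rule lim)
    moreover have "(\<integral>z. f z \<partial>distr \<nu>' borel complex_of_real) = (\<integral>x. f (complex_of_real x) \<partial>\<nu>')"
      using f(1) by (intro integral_distr borel_measurable_continuous_onI) auto
    ultimately show "(\<lambda>n. \<integral>z. f z \<partial>\<nu> (Suc n)) \<longlonglongrightarrow> (\<integral>z. f z \<partial>distr \<nu>' borel complex_of_real)"
      by simp
  qed
  then have "weakly_converges \<nu> (distr \<nu>' borel complex_of_real)"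
    by (simp add: weakly_converges_def)
  then show ?thesis
    using \<nu>' unfolding \<nu>_def \<sigma>_def by blast
qed

end
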